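(* For every integer $n\ge 1$, the free sum $A_1\oplus A_n$ is a CL-polytope.
   Context: $A_d=\mathrm{conv}(\{\pm(e_i+e_{i+1}+\dots+e_j):1\le i\le j\le d\})\subset\mathbb{R}^d$ is the root polytope of type A. For polytopes $Q_1\subset\mathbb{R}^{d_1},Q_2\subset\mathbb{R}^{d_2}$ containing the origin, $Q_1\oplus Q_2=\mathrm{conv}((Q_1\times\{0\})\cup(\{0\}\times Q_2))\subset\mathbb{R}^{d_1+d_2}$. For an integral full-dimensional polytope $Q\subset\mathbb{R}^d$, $E_Q(k)=\#(kQ\cap\mathbb{Z}^d)$ is its Ehrhart polynomial. A reflexive polytope (integral, origin in the interior, polar dual $\{x:\langle x,y\rangle\ge-1\ \forall y\in Q\}$ integral) is CL if all roots of its Ehrhart polynomial lie on the line $\mathrm{Re}(z)=-\tfrac12$ in $\mathbb{C}$. *)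

theory Defs
  imports "HOL-Analysis.Analysis" "HOL-Computational_Algebra.Polynomial"
begin

text \<open>
  The ambient space is an arbitrary Euclidean space, with the lattice spanned by its standard
  orthonormal basis. For \<open>real ^ 'n\<close> this is the set of vectors with integer
  coordinates, and for a product \<open>'a \<times> 'b\<close> of Euclidean spaces it is the
  product of the two lattices.
\<close>

definition integer_lattice :: "'a::euclidean_space set" where
  "integer_lattice = {x. \<forall>b\<in>Basis. x \<bullet> b \<in> \<int>}"

definition integral_polytope :: "'a::euclidean_space set \<Rightarrow> bool" where
  "integral_polytope Q \<longleftrightarrow>
     (\<exists>V. finite V \<and> V \<subseteq> integer_lattice \<and> Q = convex hull V)"

definition polar_dual :: "'a::euclidean_space set \<Rightarrow> 'a set" where
  "polar_dual Q = {x. \<forall>y\<in>Q. x \<bullet> y \<ge> -1}"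

definition reflexive_polytope :: "'a::euclidean_space set \<Rightarrow> bool" where
  "reflexive_polytope Q \<longleftrightarrow>
     integral_polytope Q \<and> 0 \<in> interior Q \<and> integral_polytope (polar_dual Q)"

definition lattice_count :: "'a::euclidean_space set \<Rightarrow> nat \<Rightarrow> nat" where
  "lattice_count Q k = card ((\<lambda>x. real k *\<^sub>R x) ` Q \<inter> integer_lattice)"

definition is_ehrhart_poly :: "'a::euclidean_space set \<Rightarrow> complex poly \<Rightarrow> bool" where
  "is_ehrhart_poly Q p \<longleftrightarrow> (\<forall>k\<ge>1. poly p (of_nat k) = of_nat (lattice_count Q k))"

text \<open>
  Complex coefficients allow the polynomial to be evaluated directly at points of the complex
  plane. There is at most one polynomial with the required values, as shown below; its
  existence for integral polytopes is Ehrhart's theorem, so that nothing can be concluded about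
  the description operator before existence has been proved for the polytope at hand.
\<close>

definition ehrhart_poly :: "'a::euclidean_space set \<Rightarrow> complex poly" where
  "ehrhart_poly Q = (THE p. is_ehrhart_poly Q p)"

lemma is_ehrhart_poly_unique:
  assumes "is_ehrhart_poly Q p" "is_ehrhart_poly Q q"
  shows "p = q"
proof (rule ccontr)
  assume "p \<noteq> q"
  then have "finite {z. poly (p - q) z = 0}"
    using poly_roots_finite[of "p - q"] by simp
  moreover have "of_nat ` {1..} \<subseteq> {z. poly (p - q) z = 0}"
    using assms by (auto simp: is_ehrhart_poly_def)
  ultimately have "finite (of_nat ` {1::nat..} :: complex set)"
    by (rule finite_subset[rotated])
  then have "finite {1::nat..}"
    by (rule finite_imageD) (simp add: inj_on_def)
  then show False
    by (simp add: infinite_Ici)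
qed

lemma ehrhart_poly_eqI: "is_ehrhart_poly Q p \<Longrightarrow> ehrhart_poly Q = p"
  unfolding ehrhart_poly_def by (rule the_equality) (auto intro: is_ehrhart_poly_unique)

definition CL_polytope :: "'a::euclidean_space set \<Rightarrow> bool" where
  "CL_polytope Q \<longleftrightarrow>
     reflexive_polytope Q \<and> (\<forall>z. poly (ehrhart_poly Q) z = 0 \<longrightarrow> Re z = - 1 / 2)"

text \<open>
  The coordinates of \<open>real ^ 'n\<close> are indexed by a finite linearly ordered type, whose
  elements play the role of \<open>1 < \<dots> < d\<close> with \<open>d = CARD('n)\<close>. The types
  \<open>1\<close>, \<open>2\<close>, \<open>3\<close>, \<open>\<dots>\<close> are of this kind, so that every
  dimension \<open>d \<ge> 1\<close> occurs.
\<close>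

definition root_polytope :: "(real ^ 'n::{finite,linorder}) set" where
  "root_polytope = convex hull
     (\<Union>i. \<Union>j\<in>{i..}. {\<Sum>k\<in>{i..j}. axis k 1, - (\<Sum>k\<in>{i..j}. axis k 1)})"

definition free_sum ::
  "'a::euclidean_space set \<Rightarrow> 'b::euclidean_space set \<Rightarrow> ('a \<times> 'b) set" where
  "free_sum P Q = convex hull (P \<times> {0} \<union> {0} \<times> Q)"

end

theory Submission
  imports Defs
begin

text \<open>
  In the coordinates given by differences of consecutive entries, the root polytope is the convex
  hull of \<open>\<plusminus>e\<^sub>i\<close> and \<open>e\<^sub>i - e\<^sub>j\<close>, which is the unit ball of
  \<open>y \<mapsto> max (\<Sum> y\<^sub>i\<^sup>+) (\<Sum> y\<^sub>i\<^sup>-)\<close>. Choosing the set of positive coordinates first, its \<open>m\<close>-th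
  dilate contains \<open>N\<^sub>n(m) = \<Sum>\<^sub>k C(n,k) C(m,k) C(m+n-k,n-k) = \<Sum>\<^sub>k C(n,k) C(n+k,k) C(m,k)\<close> lattice
  points, and these continuous Hahn polynomials satisfy
  \<open>(n+1)\<^sup>2 N\<^sub>n\<^sub>+\<^sub>1(z) = (2n+1)(2z+1) N\<^sub>n(z) + n\<^sup>2 N\<^sub>n\<^sub>-\<^sub>1(z)\<close>. Slicing the free sum with the segment gives
  the Ehrhart polynomial \<open>F\<^sub>n\<close> with \<open>F\<^sub>n(m+1) - F\<^sub>n(m) = N\<^sub>n(m+1) + N\<^sub>n(m)\<close>, whence
  \<open>(n+1) F\<^sub>n(z) = (2z+1) N\<^sub>n(z) + n N\<^sub>n\<^sub>-\<^sub>1(z)\<close>. If \<open>Re z > -1/2\<close>, then by induction all the ratios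
  \<open>N\<^sub>n\<^sub>+\<^sub>1(z) / N\<^sub>n(z)\<close>, and then \<open>F\<^sub>n(z) / N\<^sub>n(z)\<close>, have positive real part, because \<open>w \<mapsto> 1/w\<close>
  preserves the right half plane; \<open>Re z < -1/2\<close> is symmetric.
\<close>

section \<open>Coefficients of the shifted Legendre polynomials\<close>

lemma sum_choose_mult_choose:
  assumes "j \<le> n"
  shows "(\<Sum>k\<le>n. (n choose k) * (j choose k)) = (n + j) choose j"
proof -
  have "(\<Sum>k\<le>n. (n choose k) * (j choose k)) = (\<Sum>k\<le>j. (n choose k) * (j choose k))"
    by (rule sum.mono_neutral_right) (use assms in \<open>auto simp: binomial_eq_0\<close>)
  also have "\<dots> = (\<Sum>k\<le>j. (n choose k) * (j choose (j - k)))"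
    by (intro sum.cong refl) (simp add: binomial_symmetric[symmetric])
  finally show ?thesis by (simp add: vandermonde)
qed

text \<open>For k <= m both sides are the multinomial coefficient (m+n-k)! / (k! (m-k)! (n-k)!),
  which is symmetric in m and n. For k > m both vanish.\<close>

lemma choose_mult_choose_swap:
  assumes "k \<le> n"
  shows "(m choose k) * ((m + n - k) choose (n - k)) = (n choose k) * ((m + n - k) choose n)"
proof (cases "k \<le> m")
  case True
  have "((m + n - k) choose m) * (m choose k) = ((m + n - k) choose k) * ((m + n - k - k) choose (m - k))"
    by (rule choose_mult) (use assms True in auto)
  moreover have "((m + n - k) choose n) * (n choose k) = ((m + n - k) choose k) * ((m + n - k - k) choose (n - k))"
    by (rule choose_mult) (use assms True in auto)
  moreover have "(m + n - k) choose m = (m + n - k) choose (n - k)"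
    using assms binomial_symmetric[of m "m + n - k"] by simp
  moreover have "(m + n - k - k) choose (m - k) = (m + n - k - k) choose (n - k)"
  proof -
    have "m + n - k - k - (m - k) = n - k" using True assms by auto
    then show ?thesis using assms True binomial_symmetric[of "m - k" "m + n - k - k"] by simp
  qed
  ultimately show ?thesis by (simp add: mult.commute)
qed (use assms in \<open>auto simp: binomial_eq_0\<close>)

text \<open>Both sides count chains of a k-subset inside a j-subset of an n-set: on the left the
  complement of the larger set is chosen last.\<close>

lemma choose_mult_choose_compl:
  assumes "k \<le> n" "j \<le> n"
  shows "(n choose k) * ((n - k) choose (n - j)) = (n choose j) * (j choose k)"
proof (cases "k \<le> j")
  case True
  then have "(n - k) choose (n - j) = (n - k) choose (j - k)"
    using assms binomial_symmetric[of "j - k" "n - k"] by simp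
  then show ?thesis using choose_mult[of k j n] True assms by simp
qed (use assms in \<open>auto simp: binomial_eq_0\<close>)

text \<open>Up to sign these are the coefficients of the n-th shifted Legendre polynomial. Below
  they multiply the binomials \<open>z gchoose k\<close> instead of powers.\<close>

definition legendre_coeff :: "nat \<Rightarrow> nat \<Rightarrow> nat" where
  "legendre_coeff n k = (n choose k) * ((n + k) choose k)"

text \<open>In the lattice-point formula m occurs in two factors. The swap leaves it in one,
  Vandermonde splits that one into multiples of \<open>m choose j\<close>, and the inner sum over k
  is Vandermonde again.\<close>

lemma sum_choose3_eq_legendre:
  "(\<Sum>k\<le>n. (n choose k) * (m choose k) * ((m + n - k) choose (n - k)))
     = (\<Sum>j\<le>n. legendre_coeff n j * (m choose j))"
proof -
  have "(\<Sum>k\<le>n. (n choose k) * (m choose k) * ((m + n - k) choose (n - k)))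
      = (\<Sum>k\<le>n. (n choose k) * (n choose k) * (\<Sum>j\<le>n. (m choose j) * ((n - k) choose (n - j))))"
  proof (intro sum.cong refl)
    fix k assume "k \<in> {..n}"
    then have k: "k \<le> n" by simp
    then have "m + n - k = m + (n - k)" by simp
    then show "(n choose k) * (m choose k) * ((m + n - k) choose (n - k))
      = (n choose k) * (n choose k) * (\<Sum>j\<le>n. (m choose j) * ((n - k) choose (n - j)))"
      using choose_mult_choose_swap[OF k, of m] vandermonde[of m "n - k" n] by (simp add: ac_simps)
  qed
  also have "\<dots> = (\<Sum>k\<le>n. \<Sum>j\<le>n. (n choose j) * (m choose j) * ((n choose k) * (j choose k)))"
    unfolding sum_distrib_left
  proof (intro sum.cong refl)
    fix k j assume "k \<in> {..n}" "j \<in> {..n}"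
    then show "(n choose k) * (n choose k) * ((m choose j) * ((n - k) choose (n - j)))
      = (n choose j) * (m choose j) * ((n choose k) * (j choose k))"
      using choose_mult_choose_compl[of k n j] by (simp add: ac_simps)
  qed
  also have "\<dots> = (\<Sum>j\<le>n. (n choose j) * (m choose j) * (\<Sum>k\<le>n. (n choose k) * (j choose k)))"
    by (subst sum.swap) (simp add: sum_distrib_left)
  also have "\<dots> = (\<Sum>j\<le>n. legendre_coeff n j * (m choose j))"
    by (intro sum.cong refl) (simp add: sum_choose_mult_choose legendre_coeff_def)
  finally show ?thesis .
qed

lemma legendre_coeff_0 [simp]: "legendre_coeff n 0 = 1"
  by (simp add: legendre_coeff_def)

lemma legendre_coeff_eq_0: "n < k \<Longrightarrow> legendre_coeff n k = 0"
  by (simp add: legendre_coeff_def binomial_eq_0)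

lemma legendre_coeff_Suc_right:
  "(real k + 1)^2 * real (legendre_coeff n (Suc k))
     = (real n + real k + 1) * (real n - real k) * real (legendre_coeff n k)"
proof -
  have "(real k + 1) * real (n choose Suc k) = (real n - real k) * real (n choose k)"
    using gbinomial_mult_1[of "real n" k] by (simp add: binomial_gbinomial algebra_simps)
  moreover have "(real k + 1) * real ((n + Suc k) choose Suc k) = (real n + real k + 1) * real ((n + k) choose k)"
    using arg_cong[OF Suc_times_binomial[of k "n + k"], of real]
    by (simp only: of_nat_mult of_nat_Suc of_nat_add add_Suc_right) (simp only: ac_simps)
  ultimately show ?thesis
    unfolding legendre_coeff_def of_nat_mult power2_eq_square by algebra
qed

lemma legendre_coeff_Suc_left:
  "(real n + 1 - real k) * real (legendre_coeff (Suc n) k)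
     = (real n + 1 + real k) * real (legendre_coeff n k)"
proof -
  have "(real n + 1 - real k) * real (Suc n choose k) = (real n + 1) * real (n choose k)"
    using gbinomial_absorb_comp[of "real (Suc n)" k] by (simp add: binomial_gbinomial algebra_simps)
  moreover have "(real n + 1) * real ((Suc n + k) choose k) = (real n + real k + 1) * real ((n + k) choose k)"
  proof -
    have "(n + k) choose n = (n + k) choose k" "Suc (n + k) choose Suc n = Suc (n + k) choose k"
      using binomial_symmetric[of n "n + k"] binomial_symmetric[of "Suc n" "Suc (n + k)"] by simp_all
    then show ?thesis
      using arg_cong[OF Suc_times_binomial[of n "n + k"], of real]
      by (simp only: of_nat_mult of_nat_Suc of_nat_add add_Suc) (simp only: ac_simps)
  qed
  ultimately show ?thesis
    unfolding legendre_coeff_def of_nat_mult by algebra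
qed

text \<open>All coefficients in the recurrences below become polynomial multiples of the single
  value \<open>s\<close>, so the recurrences reduce to polynomial identities. Clearing the
  denominator (j+1)^2 keeps this valid for j > n.\<close>

lemma legendre_coeff_rel:
  fixes n j :: nat
  defines "s \<equiv> real (legendre_coeff (Suc n) j)"
  shows "(real j + 1)^2 * real (legendre_coeff n (Suc j)) = (real n - real j) * (real n + 1 - real j) * s"
    and "(real j + 1)^2 * real (legendre_coeff (Suc n) (Suc j)) = (real n + real j + 2) * (real n + 1 - real j) * s"
    and "(real j + 1)^2 * real (legendre_coeff (Suc (Suc n)) (Suc j)) = (real n + real j + 3) * (real n + real j + 2) * s"
  using legendre_coeff_Suc_right[of j n] legendre_coeff_Suc_right[of j "Suc n"]
    legendre_coeff_Suc_right[of j "Suc (Suc n)"]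
    legendre_coeff_Suc_left[of n j] legendre_coeff_Suc_left[of "Suc n" j]
  unfolding s_def of_nat_Suc by algebra+

text \<open>This compares the coefficients of \<open>z gchoose Suc j\<close> in the three-term
  recurrence; multiplication by 2z+1 acts through z C(z,k) = k C(z,k) + (k+1) C(z,k+1).\<close>

lemma legendre_coeff_rec:
  "(real n + 2)^2 * real (legendre_coeff (Suc (Suc n)) (Suc j))
    = (2 * real n + 3) * ((2 * real j + 3) * real (legendre_coeff (Suc n) (Suc j))
        + 2 * (real j + 1) * real (legendre_coeff (Suc n) j))
      + (real n + 1)^2 * real (legendre_coeff n (Suc j))" (is "?l = ?r")
proof -
  have "(real j + 1)^2 * ?l = (real j + 1)^2 * ?r"
    using legendre_coeff_rel[of j n] by algebra
  moreover have "(real j + 1)^2 \<noteq> 0" by (simp add: add_nonneg_eq_0_iff)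
  ultimately show ?thesis by (simp only: mult_cancel_left) blast
qed

text \<open>The same comparison for (n+2) F_(n+1) = (2z+1) N_(n+1) + (n+1) N_n.\<close>

lemma legendre_coeff_rec':
  "(real n + 2) * (2 * real (legendre_coeff (Suc n) j) + real (legendre_coeff (Suc n) (Suc j)))
    = (2 * real j + 3) * real (legendre_coeff (Suc n) (Suc j))
        + 2 * (real j + 1) * real (legendre_coeff (Suc n) j)
      + (real n + 1) * real (legendre_coeff n (Suc j))" (is "?l = ?r")
proof -
  have "(real j + 1)^2 * ?l = (real j + 1)^2 * ?r"
    using legendre_coeff_rel[of j n] by algebra
  moreover have "(real j + 1)^2 \<noteq> 0" by (simp add: add_nonneg_eq_0_iff)
  ultimately show ?thesis by (simp only: mult_cancel_left) blast
qed

section \<open>Three-term recurrence and roots\<close>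

definition legendre_sum :: "nat \<Rightarrow> complex \<Rightarrow> complex" where
  "legendre_sum n z = (\<Sum>k\<le>n. of_nat (legendre_coeff n k) * (z gchoose k))"

text \<open>The coefficients are forced by the value 1 at 0 and the increments N_n(m) + N_n(m+1),
  because C(z,k+1) has forward difference C(z,k).\<close>

definition ehrhart_sum :: "nat \<Rightarrow> complex \<Rightarrow> complex" where
  "ehrhart_sum n z =
     1 + (\<Sum>k\<le>n. of_nat (2 * legendre_coeff n k + legendre_coeff n (Suc k)) * (z gchoose Suc k))"

lemma legendre_sum_0 [simp]: "legendre_sum 0 z = 1"
  by (simp add: legendre_sum_def)

lemma legendre_sum_1: "legendre_sum (Suc 0) z = 2 * z + 1"
  by (simp add: legendre_sum_def legendre_coeff_def)

text \<open>The free bound M puts sums of different degree over one index range, so that they can be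
  compared termwise.\<close>

lemma legendre_sum_expand:
  assumes "n \<le> Suc M"
  shows "legendre_sum n z = 1 + (\<Sum>j\<le>M. of_nat (legendre_coeff n (Suc j)) * (z gchoose Suc j))"
proof -
  have "legendre_sum n z = (\<Sum>k\<le>Suc M. of_nat (legendre_coeff n k) * (z gchoose k))"
    unfolding legendre_sum_def
    by (rule sum.mono_neutral_left) (use assms in \<open>auto simp: legendre_coeff_eq_0\<close>)
  then show ?thesis by (simp add: sum.atMost_Suc_shift del: sum.atMost_Suc)
qed

text \<open>The extra term on the left balances the contribution of \<open>c (Suc M)\<close> at j =
  M on the right. It disappears when the coefficients stop at M.\<close>

lemma mult_gbinomial_sum:
  fixes z :: complex
  shows "(2 * z + 1) * (\<Sum>k\<le>M. c k * (z gchoose k)) + (2 * of_nat M + 3) * c (Suc M) * (z gchoose Suc M)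
    = c 0 + (\<Sum>j\<le>M. ((2 * of_nat j + 3) * c (Suc j) + 2 * (of_nat j + 1) * c j) * (z gchoose Suc j))"
proof (induction M)
  case 0
  show ?case by (simp add: algebra_simps)
next
  case (Suc M)
  have "z * (z gchoose Suc M) = (of_nat M + 1) * (z gchoose Suc M) + (of_nat M + 2) * (z gchoose Suc (Suc M))"
    using gbinomial_mult_1[of z "Suc M"] by (simp add: algebra_simps)
  then have "(2 * z + 1) * (c (Suc M) * (z gchoose Suc M))
    = (2 * of_nat M + 3) * c (Suc M) * (z gchoose Suc M) + 2 * (of_nat M + 2) * c (Suc M) * (z gchoose Suc (Suc M))"
    by algebra
  with Suc.IH show ?case
    unfolding sum.atMost_Suc of_nat_Suc by algebra
qed

lemma mult_legendre_sum:
  "(2 * z + 1) * legendre_sum (Suc n) z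
    = 1 + (\<Sum>j\<le>Suc n. ((2 * of_nat j + 3) * of_nat (legendre_coeff (Suc n) (Suc j))
        + 2 * (of_nat j + 1) * of_nat (legendre_coeff (Suc n) j)) * (z gchoose Suc j))"
  using mult_gbinomial_sum[of z "\<lambda>k. of_nat (legendre_coeff (Suc n) k)" "Suc n"]
  by (simp only: legendre_sum_def legendre_coeff_eq_0[OF lessI] legendre_coeff_0) simp

text \<open>The coefficients of \<open>z gchoose Suc j\<close> agree by
  \<open>legendre_coeff_rec\<close>; the constant terms agree because (n+2)^2 = (2n+3) +
  (n+1)^2.\<close>

lemma legendre_sum_rec:
  "(of_nat n + 2)\<^sup>2 * legendre_sum (Suc (Suc n)) z
    = (2 * of_nat n + 3) * ((2 * z + 1) * legendre_sum (Suc n) z) + (of_nat n + 1)\<^sup>2 * legendre_sum n z"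
proof -
  have h: "(of_nat n + 2)\<^sup>2 * of_nat (legendre_coeff (Suc (Suc n)) (Suc j)) =
      (2 * of_nat n + 3) * ((2 * of_nat j + 3) * of_nat (legendre_coeff (Suc n) (Suc j))
        + 2 * (of_nat j + 1) * of_nat (legendre_coeff (Suc n) j))
      + (of_nat n + 1 :: complex)\<^sup>2 * of_nat (legendre_coeff n (Suc j))" for j
    using arg_cong[OF legendre_coeff_rec[of n j], of complex_of_real] by simp
  have *: "(of_nat n + 2)\<^sup>2 * of_nat (legendre_coeff (Suc (Suc n)) (Suc j)) * (z gchoose Suc j) =
      (2 * of_nat n + 3) * (((2 * of_nat j + 3) * of_nat (legendre_coeff (Suc n) (Suc j))
        + 2 * (of_nat j + 1) * of_nat (legendre_coeff (Suc n) j)) * (z gchoose Suc j))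
      + (of_nat n + 1 :: complex)\<^sup>2 * (of_nat (legendre_coeff n (Suc j)) * (z gchoose Suc j))" for j
    using h[of j] by algebra
  have "(of_nat n + 2)\<^sup>2 * legendre_sum (Suc (Suc n)) z
    = (of_nat n + 2)\<^sup>2 + (\<Sum>j\<le>Suc n. (of_nat n + 2)\<^sup>2 * of_nat (legendre_coeff (Suc (Suc n)) (Suc j)) * (z gchoose Suc j))"
    by (subst legendre_sum_expand[of _ "Suc n"]) (simp_all only: distrib_left sum_distrib_left mult_1_right mult.assoc order.refl)
  also have "\<dots> = (2 * of_nat n + 3) * ((2 * z + 1) * legendre_sum (Suc n) z) + (of_nat n + 1)\<^sup>2 * legendre_sum n z"
    unfolding * sum.distrib sum_distrib_left[symmetric] mult_legendre_sum
    by (subst legendre_sum_expand[of n "Suc n"]) (simp, algebra)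
  finally show ?thesis .
qed

lemma ehrhart_sum_eq:
  "(of_nat n + 2) * ehrhart_sum (Suc n) z
    = (2 * z + 1) * legendre_sum (Suc n) z + (of_nat n + 1) * legendre_sum n z"
proof -
  have h: "(of_nat n + 2) * of_nat (2 * legendre_coeff (Suc n) j + legendre_coeff (Suc n) (Suc j)) =
      ((2 * of_nat j + 3) * of_nat (legendre_coeff (Suc n) (Suc j))
        + 2 * (of_nat j + 1) * of_nat (legendre_coeff (Suc n) j))
      + (of_nat n + 1 :: complex) * of_nat (legendre_coeff n (Suc j))" for j
    using arg_cong[OF legendre_coeff_rec'[of n j], of complex_of_real] by simp
  have *: "(of_nat n + 2) * of_nat (2 * legendre_coeff (Suc n) j + legendre_coeff (Suc n) (Suc j)) * (z gchoose Suc j) =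
      ((2 * of_nat j + 3) * of_nat (legendre_coeff (Suc n) (Suc j))
        + 2 * (of_nat j + 1) * of_nat (legendre_coeff (Suc n) j)) * (z gchoose Suc j)
      + (of_nat n + 1 :: complex) * (of_nat (legendre_coeff n (Suc j)) * (z gchoose Suc j))" for j
    using h[of j] by algebra
  have "(of_nat n + 2) * ehrhart_sum (Suc n) z
    = (of_nat n + 2) + (\<Sum>j\<le>Suc n. (of_nat n + 2) * of_nat (2 * legendre_coeff (Suc n) j + legendre_coeff (Suc n) (Suc j)) * (z gchoose Suc j))"
    by (simp only: ehrhart_sum_def distrib_left sum_distrib_left mult_1_right mult.assoc)
  also have "\<dots> = (2 * z + 1) * legendre_sum (Suc n) z + (of_nat n + 1) * legendre_sum n z"
    unfolding * sum.distrib sum_distrib_left[symmetric] mult_legendre_sum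
    by (subst legendre_sum_expand[of n "Suc n"]) (simp, algebra)
  finally show ?thesis .
qed

text \<open>Positivity of \<open>s * Re (p * cnj q)\<close> says that \<open>p / q\<close> lies on the same side of the
  imaginary axis as \<open>s\<close>; the right-hand side divided by \<open>p\<close> is then again on this side.\<close>

lemma Re_ratio_step:
  fixes z p q r :: complex
  assumes "0 < s * (Re z + 1 / 2)" "0 < s * Re (p * cnj q)" "a > 0" "b \<ge> 0" "c > 0"
    and r: "of_real c * r = of_real a * ((2 * z + 1) * p) + of_real b * q"
  shows "0 < s * Re (r * cnj p)"
proof -
  have "p \<noteq> 0" using assms(2) by auto
  have "c * (s * Re (r * cnj p)) = s * Re (of_real c * r * cnj p)"
    by (simp add: algebra_simps)
  \<comment> \<open>Here (2z+1) p cnj p has real part 2 |p|^2 (Re z + 1/2), and q cnj p has the same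
    real part as p cnj q.\<close>
  also have "\<dots> = 2 * a * (cmod p)\<^sup>2 * (s * (Re z + 1 / 2)) + b * (s * Re (p * cnj q))"
    unfolding r by (simp add: cmod_power2) algebra
  also have "\<dots> > 0"
  proof (rule add_pos_nonneg)
    show "0 < 2 * a * (cmod p)\<^sup>2 * (s * (Re z + 1 / 2))"
      by (rule mult_pos_pos) (use assms(1,3) \<open>p \<noteq> 0\<close> in simp_all)
    show "0 \<le> b * (s * Re (p * cnj q))"
      by (rule mult_nonneg_nonneg) (use assms(2,4) in linarith)+
  qed
  finally show ?thesis using \<open>c > 0\<close> by (simp add: zero_less_mult_iff)
qed

lemma legendre_sum_ratio:
  assumes "0 < s * (Re z + 1 / 2)"
  shows "0 < s * Re (legendre_sum (Suc n) z * cnj (legendre_sum n z))"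
proof (induction n)
  case 0
  show ?case using assms by (simp add: legendre_sum_1 algebra_simps)
next
  case (Suc n)
  show ?case
    by (rule Re_ratio_step[OF assms Suc.IH, of "2 * real n + 3" "(real n + 1)\<^sup>2" "(real n + 2)\<^sup>2"])
      (use legendre_sum_rec[of n z] in \<open>simp_all\<close>)
qed

lemma ehrhart_sum_roots:
  assumes "ehrhart_sum (Suc n) z = 0"
  shows "Re z = - 1 / 2"
proof (rule ccontr)
  assume "Re z \<noteq> - 1 / 2"
  \<comment> \<open>With this choice the hypothesis on \<open>s\<close> is that a nonzero square is
    positive, which treats both half planes at once.\<close>
  define s :: real where "s = Re z + 1 / 2"
  have s: "0 < s * (Re z + 1 / 2)"
    using \<open>Re z \<noteq> - 1 / 2\<close> unfolding s_def by (auto simp: zero_less_mult_iff)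
  have "0 < s * Re (ehrhart_sum (Suc n) z * cnj (legendre_sum (Suc n) z))"
    by (rule Re_ratio_step[OF s legendre_sum_ratio[OF s], of 1 "real n + 1" "real n + 2"])
      (use ehrhart_sum_eq[of n z] in \<open>simp_all\<close>)
  with assms show False by simp
qed

section \<open>Polynomiality and values at natural numbers\<close>

lemma ehrhart_sum_poly: "\<exists>p. \<forall>z. poly p z = ehrhart_sum n z"
proof -
  define g :: "nat \<Rightarrow> complex poly" where
    "g k = smult (1 / fact k) (\<Prod>i=0..<k. [:- of_nat i, 1:])" for k
  have "poly (g k) z = z gchoose k" for k z
    by (simp add: g_def poly_prod gbinomial_prod_rev)
  then have "poly (1 + (\<Sum>k\<le>n. smult (of_nat (2 * legendre_coeff n k + legendre_coeff n (Suc k))) (g (Suc k)))) z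
    = ehrhart_sum n z" for z
    by (simp add: ehrhart_sum_def poly_sum)
  then show ?thesis by blast
qed

lemma legendre_sum_of_nat:
  "legendre_sum n (of_nat m) = of_nat (\<Sum>k\<le>n. legendre_coeff n k * (m choose k))"
  by (simp add: legendre_sum_def binomial_gbinomial)

lemma ehrhart_sum_0: "ehrhart_sum n 0 = 1"
  by (simp add: ehrhart_sum_def)

text \<open>Pascal's rule turns the increment into the sum of (2 c_k + c_(k+1)) C(m,k). Applied to
  N_n(m+1) it shows that the c_(k+1) part is N_n(m+1) - N_n(m).\<close>

lemma ehrhart_sum_Suc:
  "ehrhart_sum n (of_nat (Suc m)) = ehrhart_sum n (of_nat m) + legendre_sum n (of_nat m) + legendre_sum n (of_nat (Suc m))"
proof -
  have g: "(of_nat (Suc m) :: complex) gchoose Suc k = (of_nat m gchoose k) + (of_nat m gchoose Suc k)" for k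
    by (simp only: binomial_gbinomial[symmetric] binomial_Suc_Suc of_nat_add)
  have shift: "(\<Sum>j\<le>n. of_nat (legendre_coeff n j) * (of_nat m gchoose j))
     = 1 + (\<Sum>j\<le>n. of_nat (legendre_coeff n (Suc j)) * ((of_nat m :: complex) gchoose Suc j))"
    using legendre_sum_expand[of n n "of_nat m"] by (simp add: legendre_sum_def)
  show ?thesis
    unfolding ehrhart_sum_def legendre_sum_expand[OF le_SucI[OF order.refl]] g
    using shift by (simp add: algebra_simps sum.distrib flip: sum_distrib_left)
qed

section \<open>Integer vectors with bounded positive and negative parts\<close>

text \<open>The index k is the number of positive coordinates: choose their positions, then k
  positive integers of sum at most a, then n-k nonnegative integers of sum at most b. The bounds are
  separate because fixing one coordinate lowers only one of them.\<close>

definition signed_count :: "nat \<Rightarrow> nat \<Rightarrow> nat \<Rightarrow> nat" where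
  "signed_count n a b = (\<Sum>k\<le>n. (n choose k) * (a choose k) * ((b + n - k) choose (n - k)))"

lemma signed_count_diag: "legendre_sum n (of_nat m) = of_nat (signed_count n m m)"
  by (simp add: legendre_sum_of_nat signed_count_def sum_choose3_eq_legendre)

lemma sum_choose_add_less:
  assumes "k \<le> n"
  shows "(\<Sum>i<b. (i + n - k) choose (n - k)) = (b + n - k) choose Suc (n - k)"
proof -
  have "(\<Sum>i<b. (i + r) choose r) = (b + r) choose Suc r" for r
    by (induction b) auto
  from this[of "n - k"] show ?thesis using assms by simp
qed

text \<open>The sums correspond to the value of one further coordinate: a nonnegative value leaves i
  <= a of the first bound, a negative one leaves i < b of the second. Both are evaluated by
  hockey-stick sums and matched through Pascal's rule.\<close>

lemma signed_count_Suc: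
  "signed_count (Suc n) a b = (\<Sum>i\<le>a. signed_count n i b) + (\<Sum>i<b. signed_count n a i)"
proof -
  have 1: "(\<Sum>i\<le>a. signed_count n i b)
      = (\<Sum>k\<le>n. (n choose k) * ((a choose Suc k) + (a choose k)) * ((b + n - k) choose (n - k)))"
    unfolding signed_count_def
    by (subst sum.swap)
      (simp add: sum_choose_upper add.commute flip: sum_distrib_left sum_distrib_right)
  have 2: "(\<Sum>i<b. signed_count n a i)
      = (\<Sum>k\<le>n. (n choose k) * (a choose k) * ((b + n - k) choose Suc (n - k)))"
    unfolding signed_count_def
    by (subst sum.swap)
      (auto simp: sum_choose_add_less simp flip: sum_distrib_left intro!: sum.cong)
  \<comment> \<open>The summands in which the new position is not positive. The term at
    \<open>Suc n\<close> vanishes, so shifting the index aligns them with the rest of Pascal's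
    rule.\<close>
  define g where "g k = (n choose k) * (a choose k) * ((b + Suc n - k) choose (Suc n - k))" for k
  have "(\<Sum>k\<le>Suc n. g k) = g 0 + (\<Sum>k\<le>n. g (Suc k))"
    by (rule sum.atMost_Suc_shift)
  then have 3: "(\<Sum>k\<le>n. g k)
     = ((b + Suc n) choose Suc n) + (\<Sum>k\<le>n. (n choose Suc k) * (a choose Suc k) * ((b + n - k) choose (n - k)))"
    by (simp add: g_def binomial_eq_0)
  have "signed_count (Suc n) a b = ((b + Suc n) choose Suc n)
      + (\<Sum>k\<le>n. (Suc n choose Suc k) * (a choose Suc k) * ((b + n - k) choose (n - k)))"
    unfolding signed_count_def by (subst sum.atMost_Suc_shift) simp
  also have "\<dots> = (\<Sum>k\<le>n. g k) + (\<Sum>k\<le>n. (n choose k) * (a choose Suc k) * ((b + n - k) choose (n - k)))"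
    unfolding 3 by (simp add: algebra_simps sum.distrib)
  also have "\<dots> = (\<Sum>i\<le>a. signed_count n i b) + (\<Sum>i<b. signed_count n a i)"
    unfolding 1 2 g_def sum.distrib[symmetric]
  proof (intro sum.cong refl)
    fix k assume "k \<in> {..n}"
    then have "Suc n - k = Suc (n - k)" "b + Suc n - k = Suc (b + n - k)" by auto
    then show "(n choose k) * (a choose k) * ((b + Suc n - k) choose (Suc n - k))
        + (n choose k) * (a choose Suc k) * ((b + n - k) choose (n - k))
      = (n choose k) * ((a choose Suc k) + (a choose k)) * ((b + n - k) choose (n - k))
        + (n choose k) * (a choose k) * ((b + n - k) choose Suc (n - k))"
      by (simp add: algebra_simps)
  qed
  finally show ?thesis .
qed

text \<open>Functions on the whole index type that vanish off S allow an induction on S inside one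
  type.\<close>

definition signed_box :: "'i set \<Rightarrow> nat \<Rightarrow> nat \<Rightarrow> ('i \<Rightarrow> int) set" where
  "signed_box S a b = {f. (\<forall>i. i \<notin> S \<longrightarrow> f i = 0) \<and>
     (\<Sum>i\<in>S. max (f i) 0) \<le> int a \<and> (\<Sum>i\<in>S. max (- f i) 0) \<le> int b}"

text \<open>The value v at s uses up v of the bound a if positive and -v of the bound b if negative;
  \<open>nat\<close> makes the other deduction 0. The range of v keeps the natural subtractions from
  truncating.\<close>

lemma bij_betw_signed_box_insert:
  assumes "finite S" "s \<notin> S"
  shows "bij_betw (\<lambda>(v, f). f(s := v))
    (SIGMA v:{- int b..int a}. signed_box S (a - nat v) (b - nat (- v))) (signed_box (insert s S) a b)"
proof (rule bij_betw_byWitness[where f' = "\<lambda>f. (f s, f(s := 0))"])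
  have upd: "(\<Sum>i\<in>S. max ((f(s := v)) i) 0) = (\<Sum>i\<in>S. max (f i) 0)"
    "(\<Sum>i\<in>S. max (- (f(s := v)) i) 0) = (\<Sum>i\<in>S. max (- f i) 0)" for f and v :: int
    using assms by (auto intro!: sum.cong)
  have nn: "0 \<le> (\<Sum>i\<in>S. max (f i) 0)" "0 \<le> (\<Sum>i\<in>S. max (- f i) 0)" for f :: "'a \<Rightarrow> int"
    by (auto intro!: sum_nonneg)
  let ?D = "SIGMA v:{- int b..int a}. signed_box S (a - nat v) (b - nat (- v))"
  show "\<forall>x\<in>?D. (\<lambda>f. (f s, f(s := 0))) ((\<lambda>(v, f). f(s := v)) x) = x"
    using assms by (auto simp: signed_box_def)
  show "\<forall>f\<in>signed_box (insert s S) a b. (\<lambda>(v, f). f(s := v)) (f s, f(s := 0)) = f"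
    by simp
  show "(\<lambda>(v, f). f(s := v)) ` ?D \<subseteq> signed_box (insert s S) a b"
    using assms by (auto simp: signed_box_def upd simp del: fun_upd_apply) (auto simp: max_def split: if_splits)
  show "(\<lambda>f. (f s, f(s := 0))) ` signed_box (insert s S) a b \<subseteq> ?D"
  proof (rule image_subsetI)
    fix f assume f: "f \<in> signed_box (insert s S) a b"
    then have "max (f s) 0 + (\<Sum>i\<in>S. max (f i) 0) \<le> int a"
      "max (- f s) 0 + (\<Sum>i\<in>S. max (- f i) 0) \<le> int b"
      using assms by (auto simp: signed_box_def)
    moreover have "\<forall>i. i \<notin> S \<longrightarrow> (f(s := 0)) i = 0" using f by (auto simp: signed_box_def)
    ultimately show "(f s, f(s := 0)) \<in> ?D"
      using nn[of f] by (auto simp: signed_box_def upd simp del: fun_upd_apply)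
  qed
qed

lemma card_signed_box:
  fixes S :: "'i set"
  assumes "finite S"
  shows "finite (signed_box S a b) \<and> card (signed_box S a b) = signed_count (card S) a b"
  using assms
proof (induction S arbitrary: a b)
  case empty
  have "signed_box ({} :: 'i set) a b = {\<lambda>_. 0}" by (auto simp: signed_box_def)
  then show ?case by (simp add: signed_count_def)
next
  case (insert s S)
  let ?B = "\<lambda>v. signed_box S (a - nat v) (b - nat (- v))"
  let ?D = "SIGMA v:{- int b..int a}. ?B v"
  let ?c = "signed_count (card S)"
  note bij = bij_betw_signed_box_insert[OF insert.hyps, of b a]
  have "finite ?D" using insert.IH by auto
  have split: "{- int b..int a} = {0..int a} \<union> {- int b..<0}" by auto
  have "card ?D = (\<Sum>v\<in>{- int b..int a}. ?c (a - nat v) (b - nat (- v)))"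
    by (simp add: insert.IH card_SigmaI)
  also have "\<dots> = (\<Sum>v\<in>{0..int a}. ?c (a - nat v) (b - nat (- v))) + (\<Sum>v\<in>{- int b..<0}. ?c (a - nat v) (b - nat (- v)))"
    unfolding split by (rule sum.union_disjoint) auto
  also have "(\<Sum>v\<in>{0..int a}. ?c (a - nat v) (b - nat (- v))) = (\<Sum>i\<le>a. ?c i b)"
    by (rule sum.reindex_bij_witness[of _ "\<lambda>i. int a - int i" "\<lambda>v. a - nat v"]) auto
  \<comment> \<open>The new index is the remaining bound b - |v|. It stays below b because v = 0
    belongs to the other sum.\<close>
  also have "(\<Sum>v\<in>{- int b..<0}. ?c (a - nat v) (b - nat (- v))) = (\<Sum>i<b. ?c a i)"
    by (rule sum.reindex_bij_witness[of _ "\<lambda>i. int i - int b" "\<lambda>v. b - nat (- v)"]) auto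
  finally have "card ?D = signed_count (card (insert s S)) a b"
    using insert.hyps by (simp add: signed_count_Suc)
  with \<open>finite ?D\<close> show ?case
    using bij_betw_finite[OF bij] bij_betw_same_card[OF bij] by simp
qed

section \<open>Unimodular maps and difference coordinates\<close>

lemma Basis_in_integer_lattice: "b \<in> Basis \<Longrightarrow> b \<in> integer_lattice"
  by (auto simp: integer_lattice_def inner_Basis)

lemma integer_lattice_inner:
  "x \<in> integer_lattice \<Longrightarrow> y \<in> integer_lattice \<Longrightarrow> x \<bullet> y \<in> \<int>"
  by (subst euclidean_inner) (auto simp: integer_lattice_def intro!: Ints_sum Ints_mult)

lemma adjoint_integer_lattice:
  fixes f :: "'a::euclidean_space \<Rightarrow> 'b::euclidean_space"
  assumes "linear f" "f ` integer_lattice \<subseteq> integer_lattice"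
  shows "adjoint f ` integer_lattice \<subseteq> integer_lattice"
proof (rule image_subsetI)
  fix y :: 'b assume y: "y \<in> integer_lattice"
  have "adjoint f y \<bullet> b \<in> \<int>" if "b \<in> Basis" for b
  proof -
    have "f b \<bullet> y \<in> \<int>"
      using assms(2) Basis_in_integer_lattice[OF that] y by (intro integer_lattice_inner) auto
    then show ?thesis using adjoint_works[OF assms(1), of b y] by (simp add: inner_commute)
  qed
  then show "adjoint f y \<in> integer_lattice" by (simp add: integer_lattice_def)
qed

lemma integral_polytope_linear_image:
  assumes "linear f" "f ` integer_lattice \<subseteq> integer_lattice" "integral_polytope Q"
  shows "integral_polytope (f ` Q)"
proof -
  obtain V where "finite V" "V \<subseteq> integer_lattice" "Q = convex hull V"
    using assms(3) by (auto simp: integral_polytope_def)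
  then show ?thesis
    unfolding integral_polytope_def using assms(1,2)
    by (intro exI[of _ "f ` V"]) (auto simp: convex_hull_linear_image)
qed

lemma mem_integer_lattice_prod:
  "(x, y) \<in> integer_lattice \<longleftrightarrow> x \<in> integer_lattice \<and> y \<in> integer_lattice"
  by (simp add: integer_lattice_def Basis_prod_def ball_Un)

lemma mem_integer_lattice_cart: "(x :: real ^ 'n) \<in> integer_lattice \<longleftrightarrow> (\<forall>i. x $ i \<in> \<int>)"
  by (auto simp: integer_lattice_def Basis_vec_def inner_axis)

lemma integral_polytope_Times:
  assumes "integral_polytope P" "integral_polytope Q"
  shows "integral_polytope (P \<times> Q)"
proof -
  obtain V W where "finite V" "V \<subseteq> integer_lattice" "P = convex hull V"
    "finite W" "W \<subseteq> integer_lattice" "Q = convex hull W"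
    using assms by (auto simp: integral_polytope_def)
  then show ?thesis
    unfolding integral_polytope_def
    by (intro exI[of _ "V \<times> W"]) (auto simp: convex_hull_Times mem_integer_lattice_prod)
qed

lemma polar_dual_convex_hull: "polar_dual (convex hull S) = polar_dual S"
proof
  show "polar_dual (convex hull S) \<subseteq> polar_dual S"
    using hull_subset[of S convex] by (auto simp: polar_dual_def)
  show "polar_dual S \<subseteq> polar_dual (convex hull S)"
  proof
    fix x assume "x \<in> polar_dual S"
    then have "convex hull S \<subseteq> {y. x \<bullet> y \<ge> -1}"
      by (intro hull_minimal convex_halfspace_ge) (auto simp: polar_dual_def)
    then show "x \<in> polar_dual (convex hull S)" by (auto simp: polar_dual_def)
  qed
qed

text \<open>The polar dual transforms by the inverse transpose \<open>adjoint g\<close>, which also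
  preserves the lattice. Each dilate keeps its number of lattice points, so both Ehrhart polynomials
  are described by the same predicate.\<close>

lemma CL_polytope_unimodular_image:
  fixes f g :: "'a::euclidean_space \<Rightarrow> 'a"
  assumes "linear f" "linear g" and fg: "\<And>x. f (g x) = x" "\<And>x. g (f x) = x"
    and lat: "f ` integer_lattice \<subseteq> integer_lattice" "g ` integer_lattice \<subseteq> integer_lattice"
    and "CL_polytope Q"
  shows "CL_polytope (f ` Q)"
proof -
  have Q: "integral_polytope Q" "0 \<in> interior Q" "integral_polytope (polar_dual Q)"
    using \<open>CL_polytope Q\<close> by (auto simp: CL_polytope_def reflexive_polytope_def)
  have "inj f" by (metis fg(2) injI)
  then have "interior (f ` Q) = f ` interior Q"
    by (rule interior_injective_linear_image[OF \<open>linear f\<close>])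
  then have int: "0 \<in> interior (f ` Q)"
    using Q(2) linear_0[OF \<open>linear f\<close>] by force
  have "polar_dual (f ` Q) = adjoint g ` polar_dual Q"
  proof (intro equalityI subsetI)
    fix x assume x: "x \<in> polar_dual (f ` Q)"
    have "adjoint g (adjoint f x) = x"
    proof (rule vector_eq_ldot[THEN iffD1], rule allI)
      show "y \<bullet> adjoint g (adjoint f x) = y \<bullet> x" for y
        by (simp add: adjoint_works assms(1,2) fg)
    qed
    moreover have "adjoint f x \<in> polar_dual Q"
      using x by (auto simp: polar_dual_def inner_commute[of "adjoint f x"] adjoint_works assms(1) inner_commute[of x])
    ultimately show "x \<in> adjoint g ` polar_dual Q" by force
  next
    fix x assume "x \<in> adjoint g ` polar_dual Q"
    then obtain u where u: "u \<in> polar_dual Q" "x = adjoint g u" by auto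
    then show "x \<in> polar_dual (f ` Q)"
      by (auto simp: polar_dual_def inner_commute[of "adjoint g u"] inner_commute[of u] adjoint_works assms(2) fg)
  qed
  then have pol: "integral_polytope (polar_dual (f ` Q))"
    using integral_polytope_linear_image[OF adjoint_linear[OF \<open>linear g\<close>] adjoint_integer_lattice[OF \<open>linear g\<close> lat(2)] Q(3)]
    by simp
  have "lattice_count (f ` Q) k = lattice_count Q k" for k
  proof -
    have "(\<lambda>x. real k *\<^sub>R x) ` f ` Q \<inter> integer_lattice = f ` ((\<lambda>x. real k *\<^sub>R x) ` Q \<inter> integer_lattice)"
    proof (intro equalityI subsetI)
      fix x assume "x \<in> (\<lambda>x. real k *\<^sub>R x) ` f ` Q \<inter> integer_lattice"
      then obtain q where q: "q \<in> Q" "x = f (real k *\<^sub>R q)" "x \<in> integer_lattice"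
        by (auto simp: linear_cmul[OF \<open>linear f\<close>])
      then have "real k *\<^sub>R q \<in> integer_lattice" using lat(2) fg(2)[of "real k *\<^sub>R q"] by force
      then show "x \<in> f ` ((\<lambda>x. real k *\<^sub>R x) ` Q \<inter> integer_lattice)" using q by blast
    next
      fix x assume "x \<in> f ` ((\<lambda>x. real k *\<^sub>R x) ` Q \<inter> integer_lattice)"
      then show "x \<in> (\<lambda>x. real k *\<^sub>R x) ` f ` Q \<inter> integer_lattice"
        using lat(1) by (auto simp: linear_cmul[OF \<open>linear f\<close>])
    qed
    then show ?thesis
      unfolding lattice_count_def by (simp add: card_image inj_on_subset[OF \<open>inj f\<close>])
  qed
  then have "ehrhart_poly (f ` Q) = ehrhart_poly Q"
    by (simp add: ehrhart_poly_def is_ehrhart_poly_def)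
  then show ?thesis
    using int pol integral_polytope_linear_image[OF \<open>linear f\<close> lat(1) Q(1)] \<open>CL_polytope Q\<close>
    by (simp add: CL_polytope_def reflexive_polytope_def)
qed

lemma linear_map_prod:
  assumes "linear f" "linear g"
  shows "linear (map_prod f g)"
  by (rule linearI) (auto simp: map_prod_def linear_add[OF assms(1)] linear_add[OF assms(2)]
      linear_cmul[OF assms(1)] linear_cmul[OF assms(2)] split: prod.splits)

lemma free_sum_linear_image:
  assumes "linear f" "linear g"
  shows "free_sum (f ` P) (g ` Q) = map_prod f g ` free_sum P Q"
proof -
  have "f ` P \<times> {0} \<union> {0} \<times> g ` Q = map_prod f g ` (P \<times> {0} \<union> {0} \<times> Q)"
    using linear_0[OF assms(1)] linear_0[OF assms(2)] by (force simp: image_Un)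
  then show ?thesis
    unfolding free_sum_def by (simp add: convex_hull_linear_image[OF linear_map_prod[OF assms]])
qed

section \<open>Difference coordinates for the root polytope\<close>

definition prefix_sum :: "real ^ 'n::{finite,linorder} \<Rightarrow> real ^ 'n::{finite,linorder}" where
  "prefix_sum y = (\<chi> k. \<Sum>i\<in>{..k}. y $ i)"

text \<open>\<open>Max {..<k}\<close> is the predecessor of k in the finite linear order; at the
  first index the missing entry counts as 0.\<close>

definition backward_diff :: "real ^ 'n::{finite,linorder} \<Rightarrow> real ^ 'n::{finite,linorder}" where
  "backward_diff x = (\<chi> k. x $ k - (if {..<k} = {} then 0 else x $ Max {..<k}))"

lemma linear_prefix_sum: "linear prefix_sum"
  by (rule linearI) (simp_all add: prefix_sum_def vec_eq_iff sum.distrib sum_distrib_left)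

lemma linear_backward_diff: "linear backward_diff"
  by (rule linearI) (simp_all add: backward_diff_def vec_eq_iff algebra_simps)

lemma atMost_Max_lessThan:
  fixes j :: "'n::{finite,linorder}"
  assumes "{..<j} \<noteq> {}"
  shows "{..Max {..<j}} = {..<j}"
proof -
  have "Max {..<j} < j" using Max_in[OF _ assms] by simp
  then show ?thesis by (auto intro: Max_ge)
qed

text \<open>The sum telescopes; the induction runs over the number of smaller indices and steps from
  k to its predecessor.\<close>

lemma prefix_sum_backward_diff: "prefix_sum (backward_diff x) = x"
proof -
  have "(\<Sum>i\<in>{..k}. backward_diff x $ i) = x $ k" for k
  proof (induction "card {..<k}" arbitrary: k rule: less_induct)
    case less
    have "{..k} = insert k {..<k}" by auto
    then have "(\<Sum>i\<in>{..k}. backward_diff x $ i) = backward_diff x $ k + (\<Sum>i\<in>{..<k}. backward_diff x $ i)"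
      by simp
    also have "\<dots> = x $ k"
    proof (cases "{..<k} = {}")
      case False
      then have "Max {..<k} < k" using Max_in[of "{..<k}"] by auto
      then have "card {..<Max {..<k}} < card {..<k}" by (intro psubset_card_mono) auto
      from less(1)[OF this] have "(\<Sum>i\<in>{..<k}. backward_diff x $ i) = x $ Max {..<k}"
        by (simp only: atMost_Max_lessThan[OF False])
      with False show ?thesis by (simp add: backward_diff_def)
    qed (simp add: backward_diff_def)
    finally show ?case .
  qed
  then show ?thesis by (simp add: prefix_sum_def vec_eq_iff)
qed

text \<open>In finite dimension a one-sided linear inverse is two-sided.\<close>

lemma backward_diff_prefix_sum:
  fixes x :: "real ^ 'n::{finite,linorder}"
  shows "backward_diff (prefix_sum x) = x"
proof -
  have "backward_diff \<circ> prefix_sum = (id :: real ^ 'n::{finite,linorder} \<Rightarrow> _)"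
    using linear_inverse_left[OF linear_prefix_sum linear_backward_diff] prefix_sum_backward_diff
    unfolding fun_eq_iff comp_apply id_apply by blast
  then show ?thesis by (simp add: fun_eq_iff)
qed

lemma prefix_sum_integer_lattice: "prefix_sum ` integer_lattice \<subseteq> integer_lattice"
  by (auto simp: mem_integer_lattice_cart prefix_sum_def intro!: Ints_sum)

lemma backward_diff_integer_lattice: "backward_diff ` integer_lattice \<subseteq> integer_lattice"
  by (auto simp: mem_integer_lattice_cart backward_diff_def intro!: Ints_diff)

text \<open>The differences of distinct points among 0 and the unit vectors.\<close>

definition diff_roots :: "(real ^ 'n) set" where
  "diff_roots = (\<Union>i. {axis i 1, - axis i 1}) \<union> (\<Union>i. \<Union>j\<in>- {i}. {axis i 1 - axis j 1})"

lemma diff_rootsI [intro]: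
  "axis i 1 \<in> diff_roots" "- axis i 1 \<in> diff_roots"
  "i \<noteq> j \<Longrightarrow> axis i 1 - axis j 1 \<in> diff_roots"
  by (auto simp: diff_roots_def)

lemma diff_rootsE:
  assumes "w \<in> diff_roots"
  obtains i where "w = axis i 1" | i where "w = - axis i 1" | i j where "i \<noteq> j" "w = axis i 1 - axis j 1"
proof -
  from assms consider i where "w \<in> {axis i 1, - axis i 1}" | i j where "j \<in> - {i}" "w \<in> {axis i 1 - axis j 1}"
    unfolding diff_roots_def by (elim UnE UN_E)
  then show thesis
  proof cases
    case (1 i)
    then show thesis using that(1,2) by blast
  next
    case (2 i j)
    then show thesis using that(3)[of i j] by simp
  qed
qed

lemma uminus_diff_roots: "w \<in> diff_roots \<Longrightarrow> - w \<in> diff_roots"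
  by (erule diff_rootsE) auto

lemma prefix_sum_axis: "prefix_sum (axis i 1) $ k = (if i \<le> k then 1 else 0)"
  by (simp add: prefix_sum_def axis_def if_distrib cong: if_cong)

lemma sum_axis_nth: "(\<Sum>k\<in>S. axis k 1) $ l = (if l \<in> S then 1 else 0 :: real)"
  for S :: "'n::finite set"
  by (simp add: axis_def if_distrib cong: if_cong)

text \<open>The map sends e_i to e_i + ... + e_d, hence e_i - e_(j+1) to e_i + ... + e_j, where
  e_(d+1) is read as 0. Both sets are closed under negation, which covers the remaining
  signs.\<close>

lemma prefix_sum_diff_roots:
  "prefix_sum ` diff_roots
    = (\<Union>i::'n::{finite,linorder}. \<Union>j\<in>{i..}. {\<Sum>k\<in>{i..j}. axis k 1, - (\<Sum>k\<in>{i..j}. axis k 1)})"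
  (is "?L = ?G")
proof
  have sym: "- x \<in> ?G" if x: "x \<in> ?G" for x
  proof -
    obtain i j where "j \<in> {i..}" "x \<in> {\<Sum>k\<in>{i..j}. axis k 1, - (\<Sum>k\<in>{i..j}. axis k 1)}"
      using x by (elim UN_E)
    then show ?thesis by (intro UN_I[of i] UN_I[of j]) auto
  qed
  have single: "prefix_sum (axis i 1) \<in> ?G" for i :: 'n
  proof -
    have "prefix_sum (axis i 1) = (\<Sum>k\<in>{i..Max UNIV}. axis k (1::real))"
      by (simp only: vec_eq_iff prefix_sum_axis sum_axis_nth) simp
    then show ?thesis by (intro UN_I[of i] UN_I[of "Max UNIV"]) auto
  qed
  have pair: "prefix_sum (axis i 1 - axis j 1) \<in> ?G" if "i < j" for i j :: 'n
  proof -
    have "{..<j} \<noteq> {}" using that by auto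
    then have le: "k \<le> Max {..<j} \<longleftrightarrow> k < j" for k
      using atMost_Max_lessThan[of j] by auto
    have "prefix_sum (axis i 1 - axis j 1) = (\<Sum>k\<in>{i..Max {..<j}}. axis k (1::real))"
      by (simp only: linear_diff[OF linear_prefix_sum] vec_eq_iff vector_minus_component prefix_sum_axis sum_axis_nth)
        (use that in \<open>auto simp: le\<close>)
    then show ?thesis using that by (intro UN_I[of i] UN_I[of "Max {..<j}"]) (auto simp: le)
  qed
  have pair': "prefix_sum (axis i 1 - axis j 1) \<in> ?G" if "i \<noteq> j" for i j :: 'n
  proof (cases "i < j")
    case False
    then have "- prefix_sum (axis j 1 - axis i 1) \<in> ?G" using that by (intro sym pair) auto
    then show ?thesis by (simp add: linear_diff[OF linear_prefix_sum])
  qed (rule pair)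
  show "?L \<subseteq> ?G"
    using single sym[OF single] pair'
    by (auto elim!: diff_rootsE simp add: linear_neg[OF linear_prefix_sum] simp del: UN_iff)
  have pos: "(\<Sum>k\<in>{i..j}. axis k 1) \<in> ?L" if "i \<le> j" for i j :: 'n
  proof (cases "{j<..} = {}")
    case True
    then have "k \<le> j" for k by (metis empty_iff greaterThan_iff not_le)
    then have "(\<Sum>k\<in>{i..j}. axis k 1) = prefix_sum (axis i 1)"
      by (simp only: vec_eq_iff prefix_sum_axis sum_axis_nth) simp
    then show ?thesis by auto
  next
    case False
    \<comment> \<open>The successor of j.\<close>
    define m where "m = Min {j<..}"
    have "m \<in> {j<..}" unfolding m_def by (rule Min_in) (use False in auto)
    have "m \<le> k" if "j < k" for k unfolding m_def by (rule Min_le) (use that in auto)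
    with \<open>m \<in> {j<..}\<close> have m: "m \<le> k \<longleftrightarrow> j < k" for k by auto
    have "(\<Sum>k\<in>{i..j}. axis k 1) = prefix_sum (axis i 1 - axis m 1)"
      by (simp only: linear_diff[OF linear_prefix_sum] vec_eq_iff vector_minus_component prefix_sum_axis sum_axis_nth)
        (use that in \<open>auto simp: m\<close>)
    moreover have "i \<noteq> m" using that \<open>m \<in> {j<..}\<close> by auto
    ultimately show ?thesis by auto
  qed
  have "- x \<in> ?L" if "x \<in> ?L" for x
    using that by (auto simp flip: linear_neg[OF linear_prefix_sum] intro: uminus_diff_roots)
  with pos show "?G \<subseteq> ?L" by auto
qed

lemma root_polytope_eq: "root_polytope = prefix_sum ` (convex hull diff_roots)"
  unfolding root_polytope_def prefix_sum_diff_roots[symmetric]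
  by (rule convex_hull_linear_image[OF linear_prefix_sum, symmetric])

lemma finite_diff_roots: "finite (diff_roots :: (real ^ 'n) set)"
  by (auto simp: diff_roots_def)

lemma diff_roots_integer_lattice: "diff_roots \<subseteq> (integer_lattice :: (real ^ 'n) set)"
  by (auto simp: diff_roots_def mem_integer_lattice_cart axis_def)

section \<open>The free sum as a unit ball\<close>

definition signed_norm :: "real ^ 'n \<Rightarrow> real" where
  "signed_norm y = max (\<Sum>i\<in>UNIV. max (y $ i) 0) (\<Sum>i\<in>UNIV. max (- y $ i) 0)"

lemma signed_norm_le_iff:
  "signed_norm y \<le> c \<longleftrightarrow> (\<Sum>i\<in>UNIV. max (y $ i) 0) \<le> c \<and> (\<Sum>i\<in>UNIV. max (- y $ i) 0) \<le> c"
  by (simp add: signed_norm_def)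

lemma signed_norm_triangle: "signed_norm (x + y) \<le> signed_norm x + signed_norm y"
proof -
  have "(\<Sum>i\<in>UNIV. max ((x + y) $ i) 0) \<le> (\<Sum>i\<in>UNIV. max (x $ i) 0) + (\<Sum>i\<in>UNIV. max (y $ i) 0)"
    "(\<Sum>i\<in>UNIV. max (- (x + y) $ i) 0) \<le> (\<Sum>i\<in>UNIV. max (- x $ i) 0) + (\<Sum>i\<in>UNIV. max (- y $ i) 0)"
    unfolding sum.distrib[symmetric] by (auto intro!: sum_mono)
  then show ?thesis unfolding signed_norm_def by linarith
qed

lemma signed_norm_scaleR: "c \<ge> 0 \<Longrightarrow> signed_norm (c *\<^sub>R x) = c * signed_norm x"
  by (simp add: signed_norm_def max_mult_distrib_left sum_distrib_left)

lemma convex_signed_norm_le: "convex {x. signed_norm x \<le> c}"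
proof (rule convexI, clarsimp)
  fix x y :: "real ^ 'a" and u v :: real
  assume *: "signed_norm x \<le> c" "signed_norm y \<le> c" "0 \<le> u" "0 \<le> v" "u + v = 1"
  have "signed_norm (u *\<^sub>R x + v *\<^sub>R y) \<le> u * signed_norm x + v * signed_norm y"
    using signed_norm_triangle[of "u *\<^sub>R x" "v *\<^sub>R y"] *(3,4) by (simp add: signed_norm_scaleR)
  also have "\<dots> \<le> u * c + v * c"
    using * by (intro add_mono mult_left_mono) auto
  also have "\<dots> = c" using *(5) by (simp flip: distrib_right)
  finally show "signed_norm (u *\<^sub>R x + v *\<^sub>R y) \<le> c" .
qed

lemma signed_norm_0 [simp]: "signed_norm 0 = 0"
  by (simp add: signed_norm_def)

lemma continuous_on_signed_norm: "continuous_on S signed_norm"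
  unfolding signed_norm_def by (intro continuous_intros)

lemma signed_norm_diff_roots: "w \<in> diff_roots \<Longrightarrow> signed_norm w \<le> 1"
proof (erule diff_rootsE)
  fix i assume "w = axis i 1"
  then have "max (w $ k) 0 = (if k = i then 1 else 0)" "max (- w $ k) 0 = 0" for k
    by (auto simp: axis_def)
  then show ?thesis by (simp add: signed_norm_le_iff)
next
  fix i assume "w = - axis i 1"
  then have "max (w $ k) 0 = 0" "max (- w $ k) 0 = (if k = i then 1 else 0)" for k
    by (auto simp: axis_def)
  then show ?thesis by (simp add: signed_norm_le_iff)
next
  fix i j :: 'a assume ij: "i \<noteq> j" "w = axis i 1 - axis j 1"
  then have "max (w $ k) 0 = (if k = i then 1 else 0)" "max (- w $ k) 0 = (if k = j then 1 else 0)" for k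
    by (auto simp: axis_def)
  then show ?thesis by (simp add: signed_norm_le_iff)
qed

lemma signed_norm_hull_diff_roots:
  assumes "x \<in> convex hull diff_roots"
  shows "signed_norm x \<le> 1"
proof -
  have "convex hull diff_roots \<subseteq> {x. signed_norm x \<le> 1}"
    by (rule hull_minimal) (auto intro: signed_norm_diff_roots convex_signed_norm_le)
  with assms show ?thesis by auto
qed

text \<open>This is the duality behind the unit ball: on positive parts the entries of q are at most
  M, on negative parts at least m, and M - m is controlled by the roots.\<close>

lemma inner_le_signed_norm:
  fixes q y :: "real ^ 'n"
  assumes "\<And>w. w \<in> diff_roots \<Longrightarrow> q \<bullet> w \<le> \<beta>"
  shows "q \<bullet> y \<le> \<beta> * signed_norm y"
proof -
  \<comment> \<open>Including 0 gives m <= 0 <= M and turns the bounds on plus and minus e_i into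
    further differences of elements of R.\<close>
  define R where "R = insert 0 (range (($) q))"
  have [simp]: "finite R" "R \<noteq> {}" by (auto simp: R_def)
  have \<beta>: "q $ i \<le> \<beta>" "- q $ i \<le> \<beta>" for i
    using assms[OF diff_rootsI(1)[of i]] assms[OF diff_rootsI(2)[of i]] by (simp_all add: inner_axis)
  have \<beta>': "q $ i - q $ j \<le> \<beta>" for i j
    using assms[OF diff_rootsI(3)[of i j]] \<beta>[of i]
    by (cases "i = j") (auto simp: inner_axis inner_diff_right)
  have "\<beta> \<ge> 0" using \<beta>'[of undefined undefined] by simp
  then have "a - b \<le> \<beta>" if "a \<in> R" "b \<in> R" for a b
    using that \<beta> \<beta>' by (auto simp: R_def)
  then have "Max R - Min R \<le> \<beta>" by simp
  moreover define M m where "M = Max R" and "m = Min R"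
  ultimately have diff: "M - m \<le> \<beta>" by simp
  have "0 \<le> M" "m \<le> 0" unfolding M_def m_def by (rule Max_ge Min_le; simp add: R_def)+
  have "q $ i * y $ i \<le> M * max (y $ i) 0 - m * max (- y $ i) 0" for i
  proof -
    have "q $ i \<le> M" "m \<le> q $ i" unfolding M_def m_def by (rule Max_ge Min_le; simp add: R_def)+
    then show ?thesis
      by (cases "y $ i \<ge> 0") (auto simp: mult_right_mono mult_right_mono_neg)
  qed
  then have "q \<bullet> y \<le> (\<Sum>i\<in>UNIV. M * max (y $ i) 0 - m * max (- y $ i) 0)"
    by (auto simp: inner_vec_def intro: sum_mono)
  also have "\<dots> = M * (\<Sum>i\<in>UNIV. max (y $ i) 0) + (- m) * (\<Sum>i\<in>UNIV. max (- y $ i) 0)"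
    by (simp add: sum_subtractf sum_distrib_left flip: sum_negf)
  also have "\<dots> \<le> M * signed_norm y + (- m) * signed_norm y"
    using \<open>0 \<le> M\<close> \<open>m \<le> 0\<close> by (intro add_mono mult_left_mono) (auto simp: signed_norm_def)
  also have "\<dots> = (M - m) * signed_norm y" by (simp add: algebra_simps)
  also have "\<dots> \<le> \<beta> * signed_norm y"
    by (intro mult_right_mono diff) (auto simp: signed_norm_def le_max_iff_disj intro!: sum_nonneg)
  finally show ?thesis .
qed

definition free_sum_roots :: "((real ^ 'm) \<times> (real ^ 'n)) set" where
  "free_sum_roots = diff_roots \<times> {0} \<union> {0} \<times> diff_roots"

definition signed_ball :: "((real ^ 'm) \<times> (real ^ 'n)) set" where
  "signed_ball = {z. signed_norm (fst z) + signed_norm (snd z) \<le> 1}"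

lemma uminus_free_sum_roots: "w \<in> free_sum_roots \<Longrightarrow> - w \<in> free_sum_roots"
  by (auto simp: free_sum_roots_def uminus_diff_roots)

lemma finite_free_sum_roots: "finite free_sum_roots"
  by (simp add: free_sum_roots_def finite_diff_roots)

lemma convex_signed_ball: "convex signed_ball"
proof (rule convexI)
  fix x y :: "(real ^ 'a) \<times> (real ^ 'b)" and u v :: real
  assume *: "x \<in> signed_ball" "y \<in> signed_ball" "0 \<le> u" "0 \<le> v" "u + v = 1"
  have "signed_norm (fst (u *\<^sub>R x + v *\<^sub>R y)) + signed_norm (snd (u *\<^sub>R x + v *\<^sub>R y))
    \<le> u * (signed_norm (fst x) + signed_norm (snd x)) + v * (signed_norm (fst y) + signed_norm (snd y))"
    using signed_norm_triangle[of "u *\<^sub>R fst x" "v *\<^sub>R fst y"] signed_norm_triangle[of "u *\<^sub>R snd x" "v *\<^sub>R snd y"] *(3,4)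
    by (simp add: signed_norm_scaleR algebra_simps)
  also have "\<dots> \<le> u * 1 + v * 1"
    using * by (intro add_mono mult_left_mono) (auto simp: signed_ball_def)
  finally show "u *\<^sub>R x + v *\<^sub>R y \<in> signed_ball"
    using *(5) by (simp add: signed_ball_def)
qed

text \<open>A point outside the hull is strictly separated by some a. The estimate for
  \<open>- a\<close> on the roots extends to both components by \<open>inner_le_signed_norm\<close>,
  and their sum contradicts the separation.\<close>

lemma signed_ball_subset_hull: "signed_ball \<subseteq> convex hull free_sum_roots"
proof (rule subsetI, rule ccontr)
  fix z :: "(real ^ 'a) \<times> (real ^ 'b)"
  let ?H = "convex hull free_sum_roots :: ((real ^ 'a) \<times> (real ^ 'b)) set"
  assume z: "z \<in> signed_ball" "z \<notin> ?H"
  have "closed ?H"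
    by (intro compact_imp_closed compact_convex_hull finite_imp_compact finite_free_sum_roots)
  then obtain a b where a: "a \<bullet> z < b" "\<And>x. x \<in> ?H \<Longrightarrow> a \<bullet> x > b"
    using separating_hyperplane_closed_point[OF convex_convex_hull _ z(2)] by blast
  have le: "(- a) \<bullet> w \<le> - b" if "w \<in> free_sum_roots" for w
    using a(2)[of w] hull_inc[OF that, of convex] by simp
  have "(- fst a) \<bullet> w \<le> - b" if "w \<in> diff_roots" for w
    using le[of "(w, 0)"] that by (simp add: free_sum_roots_def inner_prod_def)
  from inner_le_signed_norm[OF this]
  have "(- fst a) \<bullet> fst z \<le> - b * signed_norm (fst z)" .
  moreover have "(- snd a) \<bullet> w \<le> - b" if "w \<in> diff_roots" for w
    using le[of "(0, w)"] that by (simp add: free_sum_roots_def inner_prod_def)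
  from inner_le_signed_norm[OF this]
  have "(- snd a) \<bullet> snd z \<le> - b * signed_norm (snd z)" .
  ultimately have "- (a \<bullet> z) \<le> - b * (signed_norm (fst z) + signed_norm (snd z))"
    by (simp add: inner_prod_def algebra_simps)
  also have "\<dots> \<le> - b * 1"
  proof (rule mult_left_mono)
    \<comment> \<open>A root and its negative both have inner product at most -b with
      \<open>- a\<close>, so -b cannot be negative.\<close>
    obtain w :: "(real ^ 'a) \<times> (real ^ 'b)" where w: "w \<in> free_sum_roots"
      by (force simp: free_sum_roots_def)
    then show "0 \<le> - b"
      using le[OF w] le[OF uminus_free_sum_roots[OF w]] by simp
  qed (use z(1) in \<open>simp add: signed_ball_def\<close>)
  finally show False using a(1) by simp
qed

text \<open>A cycle of inclusions: hull of the roots, free sum, ball, hull of the roots.\<close>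

lemma free_sum_diff_roots:
  shows "free_sum (convex hull diff_roots) (convex hull diff_roots) = convex hull free_sum_roots" (is ?A)
    and "convex hull free_sum_roots = signed_ball" (is ?B)
proof -
  let ?F = "free_sum (convex hull diff_roots) (convex hull diff_roots)"
  have 1: "convex hull free_sum_roots \<subseteq> ?F"
    unfolding free_sum_def free_sum_roots_def
    by (intro hull_mono Un_mono Sigma_mono hull_subset order.refl)
  have "?F \<subseteq> signed_ball"
    unfolding free_sum_def
    by (intro hull_minimal convex_signed_ball) (auto simp: signed_ball_def signed_norm_hull_diff_roots)
  with 1 signed_ball_subset_hull show ?A ?B by blast+
qed

section \<open>Reflexivity and lattice points\<close>

lemma mem_polar_dual_diff_roots:
  "q \<in> polar_dual diff_roots \<longleftrightarrow> (\<forall>i. \<bar>q $ i\<bar> \<le> 1) \<and> (\<forall>i j. \<bar>q $ i - q $ j\<bar> \<le> 1)"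
proof
  assume q: "q \<in> polar_dual diff_roots"
  then have "q \<bullet> w \<ge> - 1" if "w \<in> diff_roots" for w
    using that by (auto simp: polar_dual_def)
  note q = this[OF diff_rootsI(1)] this[OF diff_rootsI(2)] this[OF diff_rootsI(3)]
  have "\<bar>q $ i\<bar> \<le> 1" for i
    using q(1,2)[of i] by (simp add: inner_axis abs_le_iff)
  moreover have "\<bar>q $ i - q $ j\<bar> \<le> 1" for i j
    using q(3)[of i j] q(3)[of j i] by (cases "i = j") (auto simp: inner_axis inner_diff_right)
  ultimately show "(\<forall>i. \<bar>q $ i\<bar> \<le> 1) \<and> (\<forall>i j. \<bar>q $ i - q $ j\<bar> \<le> 1)" by blast
next
  assume *: "(\<forall>i. \<bar>q $ i\<bar> \<le> 1) \<and> (\<forall>i j. \<bar>q $ i - q $ j\<bar> \<le> 1)"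
  have "q \<bullet> w \<ge> - 1" if "w \<in> diff_roots" for w
    using that
  proof (cases rule: diff_rootsE)
    case (1 i)
    then show ?thesis using *[THEN conjunct1, rule_format, of i] by (simp add: inner_axis)
  next
    case (2 i)
    then show ?thesis using *[THEN conjunct1, rule_format, of i] by (simp add: inner_axis)
  next
    case (3 i j)
    then show ?thesis using *[THEN conjunct2, rule_format, of i j]
      by (simp add: inner_axis inner_diff_right)
  qed
  then show "q \<in> polar_dual diff_roots" by (simp add: polar_dual_def)
qed

text \<open>All coordinates that share a fixed non-integral fractional part can be shifted
  simultaneously in both directions, since every constraint that separates them from another
  coordinate (or from 0) is strict.\<close>

lemma extreme_point_polar_dual_diff_roots:
  fixes q :: "real ^ 'n"
  assumes "q extreme_point_of polar_dual diff_roots"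
  shows "q \<in> integer_lattice"
proof (rule ccontr)
  assume "q \<notin> integer_lattice"
  then obtain k where k: "q $ k \<notin> \<int>" by (auto simp: mem_integer_lattice_cart)
  define I where "I = {i. frac (q $ i) = frac (q $ k)}"
  have bd: "\<bar>q $ i\<bar> \<le> 1" "\<bar>q $ i - q $ j\<bar> \<le> 1" for i j
    using assms by (auto simp: extreme_point_of_def mem_polar_dual_diff_roots)
  have nonint: "\<bar>x\<bar> < 1" if "\<bar>x\<bar> \<le> 1" "x \<notin> \<int>" for x :: real
  proof -
    have "\<bar>x\<bar> \<noteq> 1" using that(2) by (auto simp: abs_if split: if_splits)
    with that show ?thesis by simp
  qed
  have s1: "\<bar>q $ i\<bar> < 1" if "i \<in> I" for i
    using that k by (intro nonint bd) (auto simp: I_def simp flip: frac_eq_0_iff)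
  have s2: "\<bar>q $ i - q $ j\<bar> < 1" if "i \<in> I" "j \<notin> I" for i j
  proof (intro nonint bd notI)
    assume "q $ i - q $ j \<in> \<int>"
    then obtain n where "q $ i - q $ j = of_int n" by (auto elim: Ints_cases)
    then have "q $ i = q $ j + of_int n" by simp
    then have "frac (q $ i) = frac (q $ j)" by (simp add: frac_def)
    with that show False by (simp add: I_def)
  qed
  \<comment> \<open>The slacks of all constraints that a shift of the coordinates in I changes;
    differences of two coordinates in I stay fixed. The minimum is a safe shift in both
    directions.\<close>
  define T where "T = (\<lambda>i. 1 - \<bar>q $ i\<bar>) ` I \<union> (\<lambda>(i, j). 1 - \<bar>q $ i - q $ j\<bar>) ` (I \<times> - I)"
  have "k \<in> I" by (simp add: I_def)
  then have T: "finite T" "T \<noteq> {}" by (auto simp: T_def)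
  define \<epsilon> where "\<epsilon> = Min T"
  have "\<epsilon> > 0" unfolding \<epsilon>_def using T s1 s2 by (auto simp: T_def)
  have e1: "\<epsilon> \<le> 1 - \<bar>q $ i\<bar>" if "i \<in> I" for i
    unfolding \<epsilon>_def by (rule Min_le[OF T(1)]) (use that in \<open>auto simp: T_def\<close>)
  have e2: "\<epsilon> \<le> 1 - \<bar>q $ i - q $ j\<bar>" if "i \<in> I" "j \<notin> I" for i j
    unfolding \<epsilon>_def by (rule Min_le[OF T(1)]) (use that in \<open>force simp: T_def\<close>)
  define d :: "real ^ 'n" where "d = (\<chi> i. if i \<in> I then \<epsilon> else 0)"
  have mem: "q + s *\<^sub>R d \<in> polar_dual diff_roots" if "s = 1 \<or> s = - 1" for s
  proof -
    have "\<bar>(q + s *\<^sub>R d) $ i\<bar> \<le> 1" for i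
      using bd(1)[of i] e1[of i] \<open>\<epsilon> > 0\<close> that by (cases "i \<in> I") (auto simp: d_def)
    moreover have "\<bar>(q + s *\<^sub>R d) $ i - (q + s *\<^sub>R d) $ j\<bar> \<le> 1" for i j
      using bd(2)[of i j] e2[of i j] e2[of j i] \<open>\<epsilon> > 0\<close> that
      by (cases "i \<in> I"; cases "j \<in> I") (auto simp: d_def)
    ultimately show ?thesis by (simp add: mem_polar_dual_diff_roots)
  qed
  have "d $ k \<noteq> 0" using \<open>k \<in> I\<close> \<open>\<epsilon> > 0\<close> by (simp add: d_def)
  then have "q + d \<noteq> q - d"
    by (auto simp: vec_eq_iff intro!: exI[of _ k])
  then have "midpoint (q + d) (q - d) \<in> open_segment (q + d) (q - d)"
    by simp
  moreover have "midpoint (q + d) (q - d) = q"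
    by (simp add: midpoint_def flip: scaleR_2)
  ultimately show False
    using assms mem[of 1] mem[of "- 1"] by (fastforce simp: extreme_point_of_def)
qed

text \<open>By Minkowski's theorem the compact convex dual is the hull of its extreme points. These
  are lattice points of the cube [-1,1]^n, hence finitely many.\<close>

lemma integral_polytope_polar_dual_diff_roots:
  "integral_polytope (polar_dual diff_roots :: (real ^ 'n) set)"
proof -
  let ?C = "polar_dual diff_roots :: (real ^ 'n) set"
  have C: "?C = (\<Inter>w\<in>diff_roots. {q. w \<bullet> q \<ge> - 1})"
    by (auto simp: polar_dual_def inner_commute)
  have "closed ?C" unfolding C by (intro closed_INT ballI closed_halfspace_ge)
  have "convex ?C" unfolding C by (intro convex_INT convex_halfspace_ge)
  have "?C \<subseteq> cbox (\<chi> i. - 1) (\<chi> i. 1)"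
    by (auto simp: mem_polar_dual_diff_roots mem_box_cart abs_le_iff minus_le_iff)
  then have "compact ?C"
    using \<open>closed ?C\<close> bounded_subset[OF bounded_cbox] compact_eq_bounded_closed by blast
  define V where "V = {q. q extreme_point_of ?C}"
  have V: "V \<subseteq> ?C" "V \<subseteq> integer_lattice"
    by (auto simp: V_def extreme_point_of_def intro: extreme_point_polar_dual_diff_roots)
  have "V \<subseteq> (\<lambda>f. \<chi> i. f i) ` (UNIV \<rightarrow>\<^sub>E {- 1, 0, 1})"
  proof
    fix q assume q: "q \<in> V"
    have "q $ i \<in> {- 1, 0, 1}" for i
    proof -
      from q V have "q $ i \<in> \<int>" "\<bar>q $ i\<bar> \<le> 1"
        by (auto simp: mem_integer_lattice_cart mem_polar_dual_diff_roots)
      then obtain m :: int where "q $ i = of_int m" "\<bar>real_of_int m\<bar> \<le> 1" by (auto elim!: Ints_cases)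
      moreover from this have "m \<in> {- 1, 0, 1}" by auto
      ultimately show ?thesis by auto
    qed
    then show "q \<in> (\<lambda>f. \<chi> i. f i) ` (UNIV \<rightarrow>\<^sub>E {- 1, 0, 1})"
      by (intro image_eqI[of _ _ "($) q"]) auto
  qed
  then have "finite V"
    by (rule finite_subset) (intro finite_imageI finite_PiE; simp)
  moreover have "?C = convex hull V"
    unfolding V_def by (rule Krein_Milman_Minkowski[OF \<open>compact ?C\<close> \<open>convex ?C\<close>])
  ultimately show ?thesis using V by (auto simp: integral_polytope_def)
qed

lemma polar_dual_free_sum_roots: "polar_dual free_sum_roots = polar_dual diff_roots \<times> polar_dual diff_roots"
proof (rule set_eqI)
  show "z \<in> polar_dual free_sum_roots \<longleftrightarrow> z \<in> polar_dual diff_roots \<times> polar_dual diff_roots"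
    for z :: "(real ^ 'a) \<times> (real ^ 'b)"
    by (cases z) (simp add: polar_dual_def free_sum_roots_def ball_Un)
qed

lemma free_sum_roots_integer_lattice: "free_sum_roots \<subseteq> integer_lattice"
  by (auto simp: free_sum_roots_def mem_integer_lattice_prod mem_integer_lattice_cart[of 0]
      intro: diff_roots_integer_lattice[THEN subsetD])

lemma reflexive_polytope_free_sum_roots: "reflexive_polytope (convex hull free_sum_roots)"
  unfolding reflexive_polytope_def
proof (intro conjI)
  show "integral_polytope (convex hull free_sum_roots :: ((real ^ 'a) \<times> (real ^ 'b)) set)"
    unfolding integral_polytope_def
    by (intro exI[of _ free_sum_roots] conjI finite_free_sum_roots refl free_sum_roots_integer_lattice)
  \<comment> \<open>The strict inequality defines an open set around 0 inside the ball.\<close>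
  let ?U = "{z :: (real ^ 'a) \<times> (real ^ 'b). signed_norm (fst z) + signed_norm (snd z) < 1}"
  have "open ?U"
    by (intro open_Collect_less continuous_intros continuous_on_compose2[OF continuous_on_signed_norm]) auto
  then have "?U \<subseteq> interior signed_ball"
    by (intro interior_maximal) (auto simp: signed_ball_def)
  then show "0 \<in> interior (convex hull free_sum_roots :: ((real ^ 'a) \<times> (real ^ 'b)) set)"
    unfolding free_sum_diff_roots by auto
  show "integral_polytope (polar_dual (convex hull free_sum_roots :: ((real ^ 'a) \<times> (real ^ 'b)) set))"
    unfolding polar_dual_convex_hull polar_dual_free_sum_roots
    by (intro integral_polytope_Times integral_polytope_polar_dual_diff_roots)
qed

section \<open>Counting lattice points in the dilates\<close>

lemma signed_norm_of_int_le_iff: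
  "signed_norm (\<chi> i. of_int (f i)) \<le> real c \<longleftrightarrow> f \<in> signed_box UNIV c c"
proof -
  have *: "max (real_of_int a) 0 = of_int (max a 0)" "max (- real_of_int a) 0 = of_int (max (- a) 0)" for a
    by auto
  have "signed_norm (\<chi> i. of_int (f i)) \<le> real c \<longleftrightarrow>
      real_of_int (\<Sum>i\<in>UNIV. max (f i) 0) \<le> real_of_int (int c) \<and>
      real_of_int (\<Sum>i\<in>UNIV. max (- f i) 0) \<le> real_of_int (int c)"
    by (simp add: signed_norm_le_iff *)
  then show ?thesis
    unfolding of_int_le_iff by (simp add: signed_box_def)
qed

lemma signed_norm_1: "signed_norm (x :: real ^ 1) = \<bar>x $ 1\<bar>"
  by (simp add: signed_norm_def sum_1)

text \<open>Slicing at first coordinate v leaves the dilate by m - |v| in the second factor.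
  Negative v give the sum over i < m, the others the sum over i <= m.\<close>

lemma lattice_count_signed_ball:
  assumes "m \<ge> 1"
  shows "lattice_count (signed_ball :: ((real ^ 1) \<times> (real ^ 'n)) set) m
    = (\<Sum>i<m. signed_count CARD('n) i i) + (\<Sum>i\<le>m. signed_count CARD('n) i i)"
proof -
  let ?B = "signed_ball :: ((real ^ 1) \<times> (real ^ 'n)) set"
  let ?D = "SIGMA v:{- int m..int m}. signed_box (UNIV :: 'n set) (m - nat \<bar>v\<bar>) (m - nat \<bar>v\<bar>)"
  let ?h = "\<lambda>(v, f). ((\<chi> _. of_int v) :: real ^ 1, (\<chi> i. of_int (f i)) :: real ^ 'n)"
  let ?c = "\<lambda>i. signed_count CARD('n) i i"
  have scaled: "(\<lambda>x. real m *\<^sub>R x) ` ?B = {z. signed_norm (fst z) + signed_norm (snd z) \<le> real m}"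
  proof (intro equalityI subsetI)
    fix z assume "z \<in> (\<lambda>x. real m *\<^sub>R x) ` ?B"
    then obtain x where x: "signed_norm (fst x) + signed_norm (snd x) \<le> 1" "z = real m *\<^sub>R x"
      by (auto simp: signed_ball_def)
    from mult_left_mono[OF x(1), of "real m"] show "z \<in> {z. signed_norm (fst z) + signed_norm (snd z) \<le> real m}"
      by (simp add: x(2) signed_norm_scaleR distrib_left)
  next
    fix z :: "(real ^ 1) \<times> (real ^ 'n)"
    assume "z \<in> {z. signed_norm (fst z) + signed_norm (snd z) \<le> real m}"
    then have "(1 / real m) *\<^sub>R z \<in> ?B"
      using assms by (simp add: signed_ball_def signed_norm_scaleR field_simps)
    moreover have "z = real m *\<^sub>R (1 / real m) *\<^sub>R z" using assms by simp
    ultimately show "z \<in> (\<lambda>x. real m *\<^sub>R x) ` ?B" by blast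
  qed
  have mem: "?h (v, f) \<in> (\<lambda>x. real m *\<^sub>R x) ` ?B \<longleftrightarrow> (v, f) \<in> ?D" for v and f :: "'n \<Rightarrow> int"
  proof -
    \<comment> \<open>Nonnegativity forces |v| <= m, so the natural subtraction m - |v| is
      exact.\<close>
    have "0 \<le> signed_norm (\<chi> i. of_int (f i) :: real ^ 'n)"
      by (auto simp: signed_norm_def le_max_iff_disj intro!: sum_nonneg)
    then have "?h (v, f) \<in> (\<lambda>x. real m *\<^sub>R x) ` ?B \<longleftrightarrow>
        \<bar>v\<bar> \<le> int m \<and> signed_norm (\<chi> i. of_int (f i) :: real ^ 'n) \<le> real (m - nat \<bar>v\<bar>)"
      unfolding scaled by (auto simp: signed_norm_1 of_nat_diff)
    then show ?thesis by (auto simp: signed_norm_of_int_le_iff)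
  qed
  have "bij_betw ?h ?D ((\<lambda>x. real m *\<^sub>R x) ` ?B \<inter> integer_lattice)"
  proof (rule bij_betw_imageI)
    show "inj_on ?h ?D" by (auto simp: inj_on_def vec_eq_iff fun_eq_iff)
    show "?h ` ?D = (\<lambda>x. real m *\<^sub>R x) ` ?B \<inter> integer_lattice"
    proof (intro equalityI subsetI)
      fix z assume "z \<in> ?h ` ?D"
      then obtain v f where vf: "(v, f) \<in> ?D" "z = ?h (v, f)" by blast
      moreover have "?h (v, f) \<in> integer_lattice"
        by (simp add: mem_integer_lattice_prod mem_integer_lattice_cart)
      ultimately show "z \<in> (\<lambda>x. real m *\<^sub>R x) ` ?B \<inter> integer_lattice" using mem[of v f] by blast
    next
      fix z assume z: "z \<in> (\<lambda>x. real m *\<^sub>R x) ` ?B \<inter> integer_lattice"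
      then have "fst z \<in> integer_lattice" "snd z \<in> integer_lattice"
        using mem_integer_lattice_prod[of "fst z" "snd z"] by simp_all
      then have "fst z $ i \<in> \<int>" "snd z $ j \<in> \<int>" for i j
        unfolding mem_integer_lattice_cart by blast+
      then have "z = ?h (\<lfloor>fst z $ 1\<rfloor>, \<lambda>i. \<lfloor>snd z $ i\<rfloor>)"
        by (simp add: prod_eq_iff vec_eq_iff)
      moreover from this have "(\<lfloor>fst z $ 1\<rfloor>, \<lambda>i. \<lfloor>snd z $ i\<rfloor>) \<in> ?D"
        using z mem[of "\<lfloor>fst z $ 1\<rfloor>" "\<lambda>i. \<lfloor>snd z $ i\<rfloor>"] by simp
      ultimately show "z \<in> ?h ` ?D" by (rule image_eqI)
    qed
  qed
  then have "lattice_count ?B m = card ?D"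
    unfolding lattice_count_def by (simp add: bij_betw_same_card)
  also have "\<dots> = (\<Sum>v\<in>{- int m..int m}. ?c (m - nat \<bar>v\<bar>))"
    by (simp add: card_signed_box card_SigmaI)
  also have "\<dots> = (\<Sum>v\<in>{- int m..<0}. ?c (m - nat \<bar>v\<bar>)) + (\<Sum>v\<in>{0..int m}. ?c (m - nat \<bar>v\<bar>))"
  proof -
    have "{- int m..int m} = {- int m..<0} \<union> {0..int m}" by auto
    then show ?thesis by (simp only:) (rule sum.union_disjoint; auto)
  qed
  also have "(\<Sum>v\<in>{- int m..<0}. ?c (m - nat \<bar>v\<bar>)) = (\<Sum>i<m. ?c i)"
    by (rule sum.reindex_bij_witness[of _ "\<lambda>i. int i - int m" "\<lambda>v. m - nat \<bar>v\<bar>"]) auto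
  also have "(\<Sum>v\<in>{0..int m}. ?c (m - nat \<bar>v\<bar>)) = (\<Sum>i\<le>m. ?c i)"
    by (rule sum.reindex_bij_witness[of _ "\<lambda>i. int m - int i" "\<lambda>v. m - nat \<bar>v\<bar>"]) auto
  finally show ?thesis .
qed

text \<open>Both sides are 1 at m = 0 and have the same increments by
  \<open>ehrhart_sum_Suc\<close>.\<close>

lemma ehrhart_sum_of_nat:
  "ehrhart_sum n (of_nat m) = of_nat ((\<Sum>i<m. signed_count n i i) + (\<Sum>i\<le>m. signed_count n i i))"
proof (induction m)
  case 0
  have "of_nat (signed_count n 0 0) = legendre_sum n 0" using signed_count_diag[of n 0] by simp
  then show ?case by (simp add: ehrhart_sum_0 legendre_sum_expand[of n n])
next
  case (Suc m)
  show ?case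
    unfolding ehrhart_sum_Suc Suc.IH signed_count_diag by (simp add: algebra_simps flip: lessThan_Suc_atMost)
qed

lemma CL_polytope_free_sum_roots:
  "CL_polytope (convex hull free_sum_roots :: ((real ^ 1) \<times> (real ^ 'n)) set)"
proof -
  obtain p where p: "\<And>z. poly p z = ehrhart_sum CARD('n) z" using ehrhart_sum_poly by blast
  have "is_ehrhart_poly (convex hull free_sum_roots :: ((real ^ 1) \<times> (real ^ 'n)) set) p"
    by (simp add: is_ehrhart_poly_def p free_sum_diff_roots(2) lattice_count_signed_ball ehrhart_sum_of_nat)
  then have "ehrhart_poly (convex hull free_sum_roots :: ((real ^ 1) \<times> (real ^ 'n)) set) = p"
    by (rule ehrhart_poly_eqI)
  moreover obtain n where "CARD('n) = Suc n"
    using not0_implies_Suc zero_less_card_finite by blast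
  ultimately show ?thesis
    using ehrhart_sum_roots by (simp add: CL_polytope_def reflexive_polytope_free_sum_roots p)
qed

theorem theorem4:
  shows "CL_polytope
    (free_sum (root_polytope :: (real ^ 1) set)
              (root_polytope :: (real ^ 'n::{finite,linorder}) set))"
proof -
  \<comment> \<open>Both summands are images of hulls of \<open>diff_roots\<close>, so the free sum
    is the image of one ball under a product of unimodular maps.\<close>
  have "CL_polytope (map_prod prefix_sum prefix_sum `
      (convex hull free_sum_roots :: ((real ^ 1) \<times> (real ^ 'n::{finite,linorder})) set))"
  proof (rule CL_polytope_unimodular_image[where g = "map_prod backward_diff backward_diff"])
    show "map_prod prefix_sum prefix_sum ` integer_lattice \<subseteq> (integer_lattice :: ((real ^ 1) \<times> (real ^ 'n::{finite,linorder})) set)"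
      by (auto simp: mem_integer_lattice_prod intro: prefix_sum_integer_lattice[THEN subsetD, OF imageI])
    show "map_prod backward_diff backward_diff ` integer_lattice \<subseteq> (integer_lattice :: ((real ^ 1) \<times> (real ^ 'n::{finite,linorder})) set)"
      by (auto simp: mem_integer_lattice_prod intro: backward_diff_integer_lattice[THEN subsetD, OF imageI])
  qed (auto simp: linear_map_prod linear_prefix_sum linear_backward_diff prefix_sum_backward_diff
      backward_diff_prefix_sum CL_polytope_free_sum_roots)
  then show ?thesis
    by (simp add: root_polytope_eq free_sum_linear_image linear_prefix_sum free_sum_diff_roots(1))
qed

end
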